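(* Let $G,H$ be finitely generated groups such that $H$ is non-trivial and $G$ is infinite. Then the standard wreath product $H\wr G$ is densely related.
   Context: The standard wreath product is $H\wr G=\big(\bigoplus_{g\in G}H\big)\rtimes G$, where $G$ acts by permuting the coordinates through left translation on $G$. For a group $\Gamma$ with a generating subset $S$, let $F_S$ be the free group on $S$ with its word length, let $N$ be the kernel of the natural map $F_S\to \Gamma$, and for $n\ge 0$ let $N_n$ be the normal subgroup of $F_S$ generated (as a normal subgroup) by the elements of $N$ of length at most $n$ ($N_{-1}$ is trivial). The relation range $\mathcal{R}_S(\Gamma)$ is the set of integers $n\ge 0$ such that $N_n$ properly contains $N_{n-1}$. A finitely generated group $\Gamma$ is densely related if, for a finite generating subset $S$, there exists $c>0$ such that for all integers $n\ge 1$ we have $\mathcal{R}_S(\Gamma)\cap[n,cn]\neq\emptyset$ (this does not depend on $S$). *)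

theory Defs
  imports Complex_Main "HOL-Algebra.Product_Groups"
begin

section \<open>Wreath products\<close>

definition semidirect_product ::
    "('a, 'm) monoid_scheme \<Rightarrow> ('b, 'n) monoid_scheme \<Rightarrow> ('b \<Rightarrow> 'a \<Rightarrow> 'a) \<Rightarrow> ('a \<times> 'b) monoid" where
  "semidirect_product A B \<phi> =
     \<lparr>carrier = carrier A \<times> carrier B,
      mult = (\<lambda>(a, b) (a', b'). (a \<otimes>\<^bsub>A\<^esub> \<phi> b a', b \<otimes>\<^bsub>B\<^esub> b')),
      one = (\<one>\<^bsub>A\<^esub>, \<one>\<^bsub>B\<^esub>)\<rparr>"

text \<open>Permuting the coordinates by left translation moves the entry in position \<open>x\<close> to position
  \<open>g x\<close>, whence the inverse in the formula.\<close>

definition left_translation :: "('g, 'm) monoid_scheme \<Rightarrow> 'g \<Rightarrow> ('g \<Rightarrow> 'h) \<Rightarrow> 'g \<Rightarrow> 'h" where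
  "left_translation G g f = (\<lambda>x\<in>carrier G. f (inv\<^bsub>G\<^esub> g \<otimes>\<^bsub>G\<^esub> x))"

definition wreath_product ::
    "('h, 'n) monoid_scheme \<Rightarrow> ('g, 'm) monoid_scheme \<Rightarrow> (('g \<Rightarrow> 'h) \<times> 'g) monoid" where
  "wreath_product H G =
     semidirect_product (sum_group (carrier G) (\<lambda>_. H)) G (left_translation G)"

section \<open>Free groups\<close>

text \<open>A letter \<open>(s, True)\<close> stands for \<open>s\<close> and \<open>(s, False)\<close> for its formal inverse.  The elements of
  the free group are the reduced words, so that the word length of an element is its length as a
  list.\<close>

type_synonym 'a letter = "'a \<times> bool"

definition inv_letter :: "'a letter \<Rightarrow> 'a letter" where
  "inv_letter x = (fst x, \<not> snd x)"

fun reduced :: "'a letter list \<Rightarrow> bool" where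
  "reduced (x # y # w) \<longleftrightarrow> y \<noteq> inv_letter x \<and> reduced (y # w)"
| "reduced w \<longleftrightarrow> True"

fun reduced_Cons :: "'a letter \<Rightarrow> 'a letter list \<Rightarrow> 'a letter list" where
  "reduced_Cons x [] = [x]"
| "reduced_Cons x (y # w) = (if y = inv_letter x then w else x # y # w)"

definition free_group :: "'a set \<Rightarrow> 'a letter list monoid" where
  "free_group S =
     \<lparr>carrier = {w \<in> lists (S \<times> UNIV). reduced w},
      mult = foldr reduced_Cons,
      one = []\<rparr>"

definition eval_letter :: "('a, 'm) monoid_scheme \<Rightarrow> 'a letter \<Rightarrow> 'a" where
  "eval_letter \<Gamma> x = (if snd x then fst x else inv\<^bsub>\<Gamma>\<^esub> (fst x))"

definition eval_word :: "('a, 'm) monoid_scheme \<Rightarrow> 'a letter list \<Rightarrow> 'a" where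
  "eval_word \<Gamma> w = foldr (\<lambda>x g. eval_letter \<Gamma> x \<otimes>\<^bsub>\<Gamma>\<^esub> g) w \<one>\<^bsub>\<Gamma>\<^esub>"

section \<open>Dense relatedness\<close>

definition normal_closure :: "('a, 'm) monoid_scheme \<Rightarrow> 'a set \<Rightarrow> 'a set" where
  "normal_closure G A = \<Inter>{K. K \<lhd> G \<and> A \<subseteq> K}"

definition relators :: "('a, 'm) monoid_scheme \<Rightarrow> 'a set \<Rightarrow> 'a letter list set" where
  "relators \<Gamma> S = kernel (free_group S) \<Gamma> (eval_word \<Gamma>)"

definition short_relators_closure ::
    "('a, 'm) monoid_scheme \<Rightarrow> 'a set \<Rightarrow> nat \<Rightarrow> 'a letter list set" where
  "short_relators_closure \<Gamma> S n = normal_closure (free_group S) {w \<in> relators \<Gamma> S. length w \<le> n}"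

definition relation_range :: "('a, 'm) monoid_scheme \<Rightarrow> 'a set \<Rightarrow> nat set" where
  "relation_range \<Gamma> S =
     {n. (case n of 0 \<Rightarrow> {\<one>\<^bsub>free_group S\<^esub>} | Suc m \<Rightarrow> short_relators_closure \<Gamma> S m)
           \<subset> short_relators_closure \<Gamma> S n}"

definition generating_set :: "('a, 'm) monoid_scheme \<Rightarrow> 'a set \<Rightarrow> bool" where
  "generating_set \<Gamma> S \<longleftrightarrow> S \<subseteq> carrier \<Gamma> \<and> generate \<Gamma> S = carrier \<Gamma>"

definition finitely_generated_group :: "('a, 'm) monoid_scheme \<Rightarrow> bool" where
  "finitely_generated_group \<Gamma> \<longleftrightarrow> group \<Gamma> \<and> (\<exists>S. finite S \<and> generating_set \<Gamma> S)"

text \<open>The condition does not depend on the finite generating set \<open>S\<close>; it is imposed for all of them.\<close>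

definition densely_related :: "('a, 'm) monoid_scheme \<Rightarrow> bool" where
  "densely_related \<Gamma> \<longleftrightarrow>
     finitely_generated_group \<Gamma> \<and>
     (\<forall>S. finite S \<and> generating_set \<Gamma> S \<longrightarrow>
       (\<exists>c::real. c > 0 \<and>
         (\<forall>n::nat. n \<ge> 1 \<longrightarrow>
           (\<exists>k \<in> relation_range \<Gamma> S. real n \<le> real k \<and> real k \<le> c * real n))))"

section \<open>Basic facts\<close>

lemma inv_letter_inv_letter [simp]: "inv_letter (inv_letter x) = x"
  by (simp add: inv_letter_def)

lemma inv_letter_neq [simp]: "inv_letter x \<noteq> x" "x \<noteq> inv_letter x"
  by (auto simp: inv_letter_def prod_eq_iff)

lemma inv_letter_in_iff [simp]: "inv_letter x \<in> S \<times> UNIV \<longleftrightarrow> x \<in> S \<times> UNIV"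
  by (auto simp: inv_letter_def mem_Times_iff)

lemma reduced_ConsD: "reduced (x # w) \<Longrightarrow> reduced w"
  by (cases w) auto

lemma reduced_reduced_Cons: "reduced w \<Longrightarrow> reduced (reduced_Cons x w)"
  by (cases w) (auto dest: reduced_ConsD)

lemma reduced_Cons_reduced: "reduced (x # w) \<Longrightarrow> reduced_Cons x w = x # w"
  by (cases w) auto

lemma reduced_Cons_cancel: "reduced w \<Longrightarrow> reduced_Cons x (reduced_Cons (inv_letter x) w) = w"
  by (cases w) (auto simp: reduced_Cons_reduced)

lemma reduced_foldr: "reduced v \<Longrightarrow> reduced (foldr reduced_Cons u v)"
  by (induction u) (auto intro: reduced_reduced_Cons)

lemma reduced_Cons_in_lists:
  "x \<in> A \<Longrightarrow> w \<in> lists A \<Longrightarrow> reduced_Cons x w \<in> lists A"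
  by (cases w) auto

lemma foldr_in_lists:
  "u \<in> lists A \<Longrightarrow> v \<in> lists A \<Longrightarrow> foldr reduced_Cons u v \<in> lists A"
proof (induction u)
  case (Cons x u)
  then show ?case using reduced_Cons_in_lists[of x A "foldr reduced_Cons u v"] by simp
qed simp

lemma foldr_reduced_Cons:
  assumes "reduced w"
  shows "foldr reduced_Cons (reduced_Cons x v) w = reduced_Cons x (foldr reduced_Cons v w)"
proof (cases v)
  case (Cons y v')
  have "reduced_Cons x (reduced_Cons (inv_letter x) (foldr reduced_Cons v' w)) =
      foldr reduced_Cons v' w"
    by (intro reduced_Cons_cancel reduced_foldr assms)
  then show ?thesis using Cons by auto
qed simp

lemma foldr_foldr_reduced_Cons:
  assumes "reduced w"
  shows "foldr reduced_Cons (foldr reduced_Cons u v) w =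
      foldr reduced_Cons u (foldr reduced_Cons v w)"
  by (induction u) (simp_all add: foldr_reduced_Cons assms)

lemma foldr_reduced_Cons_Nil: "reduced w \<Longrightarrow> foldr reduced_Cons w [] = w"
proof (induction w)
  case (Cons x w)
  then show ?case using reduced_ConsD[of x w] reduced_Cons_reduced[of x w] by simp
qed simp

lemma foldr_inverse_word:
  "reduced v \<Longrightarrow> foldr reduced_Cons (rev (map inv_letter w)) (foldr reduced_Cons w v) = v"
proof (induction w arbitrary: v)
  case (Cons x w)
  have "reduced_Cons (inv_letter x) (reduced_Cons x (foldr reduced_Cons w v)) =
      foldr reduced_Cons w v"
    using reduced_Cons_cancel[of "foldr reduced_Cons w v" "inv_letter x"] Cons.prems
    by (simp add: reduced_foldr)
  with Cons show ?case by simp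
qed simp

lemma group_free_group: "group (free_group S)"
proof (rule groupI)
  fix u v assume "u \<in> carrier (free_group S)" "v \<in> carrier (free_group S)"
  then show "u \<otimes>\<^bsub>free_group S\<^esub> v \<in> carrier (free_group S)"
    using foldr_in_lists[of u "S \<times> UNIV" v] by (simp add: free_group_def reduced_foldr)
next
  fix w assume w: "w \<in> carrier (free_group S)"
  define v where "v = foldr reduced_Cons (rev (map inv_letter w)) []"
  have "rev (map inv_letter w) \<in> lists (S \<times> UNIV)"
    using w by (auto simp: free_group_def in_lists_conv_set inv_letter_def)
  then have "v \<in> carrier (free_group S)"
    unfolding v_def using foldr_in_lists[of _ "S \<times> UNIV" "[]"]
    by (simp add: free_group_def reduced_foldr)
  moreover have "foldr reduced_Cons v w = []"
  proof -
    have "foldr reduced_Cons v w = foldr reduced_Cons (rev (map inv_letter w)) w"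
      using w by (simp add: v_def free_group_def foldr_foldr_reduced_Cons)
    also have "\<dots> = []"
      using foldr_inverse_word[of "[]" w] w
      by (simp add: free_group_def foldr_reduced_Cons_Nil)
    finally show ?thesis .
  qed
  ultimately show "\<exists>y\<in>carrier (free_group S). y \<otimes>\<^bsub>free_group S\<^esub> w = \<one>\<^bsub>free_group S\<^esub>"
    by (auto simp: free_group_def)
qed (auto simp: free_group_def foldr_foldr_reduced_Cons)

lemma (in group) eval_letter_closed: "x \<in> S \<times> UNIV \<Longrightarrow> S \<subseteq> carrier G \<Longrightarrow> eval_letter G x \<in> carrier G"
  by (auto simp: eval_letter_def)

lemma (in group) eval_word_closed:
  "w \<in> lists (S \<times> UNIV) \<Longrightarrow> S \<subseteq> carrier G \<Longrightarrow> eval_word G w \<in> carrier G"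
  by (induction w) (auto simp: eval_word_def eval_letter_def)

lemma (in group) eval_word_reduced_Cons:
  assumes "x \<in> S \<times> UNIV" "w \<in> lists (S \<times> UNIV)" "S \<subseteq> carrier G"
  shows "eval_word G (reduced_Cons x w) = eval_letter G x \<otimes> eval_word G w"
proof (cases w)
  case (Cons y v)
  have v: "eval_word G v \<in> carrier G" and x: "fst x \<in> carrier G"
    using assms Cons eval_word_closed[of v S] by auto
  have "eval_letter G x \<otimes> (eval_letter G (inv_letter x) \<otimes> eval_word G v) = eval_word G v"
    using v x by (cases "snd x") (auto simp: eval_letter_def inv_letter_def m_assoc[symmetric])
  then show ?thesis
    using Cons by (auto simp: eval_word_def)
qed (simp add: eval_word_def)

lemma (in group) eval_word_hom:
  assumes "S \<subseteq> carrier G"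
  shows "eval_word G \<in> hom (free_group S) G"
proof (rule homI)
  fix u v assume "u \<in> carrier (free_group S)" and v: "v \<in> carrier (free_group S)"
  then have "u \<in> lists (S \<times> UNIV)" by (simp add: free_group_def)
  then have "eval_word G (foldr reduced_Cons u v) = eval_word G u \<otimes> eval_word G v"
  proof (induction u)
    case Nil
    then show ?case
      using v assms eval_word_closed[of v S] by (simp add: free_group_def eval_word_def)
  next
    case (Cons x u)
    have "v \<in> lists (S \<times> UNIV)" using v by (simp add: free_group_def)
    with Cons assms show ?case
      using eval_word_closed[of u S] eval_word_closed[of v S] eval_letter_closed[of x S]
      by (simp add: eval_word_reduced_Cons[where S = S] foldr_in_lists)
        (simp add: eval_word_def m_assoc)
  qed
  then show "eval_word G (u \<otimes>\<^bsub>free_group S\<^esub> v) = eval_word G u \<otimes> eval_word G v"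
    by (simp add: free_group_def)
qed (use assms eval_word_closed in \<open>auto simp: free_group_def\<close>)

lemma group_wreath_product:
  assumes "group H" "group G"
  shows "group (wreath_product H G)"
proof -
  interpret H: group H by fact
  interpret G: group G by fact
  let ?A = "sum_group (carrier G) (\<lambda>_. H)"
  interpret A: group ?A by (simp add: assms)
  have carr: "carrier ?A = {f \<in> carrier G \<rightarrow>\<^sub>E carrier H. finite {x \<in> carrier G. f x \<noteq> \<one>\<^bsub>H\<^esub>}}"
    by (simp add: carrier_sum_group assms)
  have closed: "left_translation G g f \<in> carrier ?A"
    if g: "g \<in> carrier G" and f: "f \<in> carrier ?A" for g f
  proof -
    have "{x \<in> carrier G. left_translation G g f x \<noteq> \<one>\<^bsub>H\<^esub>} \<subseteq>
        (\<lambda>x. g \<otimes>\<^bsub>G\<^esub> x) ` {x \<in> carrier G. f x \<noteq> \<one>\<^bsub>H\<^esub>}"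
    proof
      fix x assume "x \<in> {x \<in> carrier G. left_translation G g f x \<noteq> \<one>\<^bsub>H\<^esub>}"
      then show "x \<in> (\<lambda>x. g \<otimes>\<^bsub>G\<^esub> x) ` {x \<in> carrier G. f x \<noteq> \<one>\<^bsub>H\<^esub>}"
        using g
        by (intro image_eqI[of _ _ "inv\<^bsub>G\<^esub> g \<otimes>\<^bsub>G\<^esub> x"])
          (auto simp: left_translation_def G.m_assoc[symmetric])
    qed
    then have "finite {x \<in> carrier G. left_translation G g f x \<noteq> \<one>\<^bsub>H\<^esub>}"
      using f by (auto simp: carr intro: finite_subset)
    then show ?thesis
      using f g by (auto simp: carr left_translation_def PiE_iff)
  qed
  have mult: "left_translation G g (f \<otimes>\<^bsub>?A\<^esub> f') =
      left_translation G g f \<otimes>\<^bsub>?A\<^esub> left_translation G g f'" if "g \<in> carrier G" for g f f'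
    using that by (auto simp: left_translation_def)
  have comp: "left_translation G (g \<otimes>\<^bsub>G\<^esub> h) f = left_translation G g (left_translation G h f)"
    if "g \<in> carrier G" "h \<in> carrier G" for g h f
    using that by (auto simp: left_translation_def G.inv_mult_group G.m_assoc)
  have one: "left_translation G \<one>\<^bsub>G\<^esub> f = f" if "f \<in> carrier ?A" for f
    using that by (auto simp: left_translation_def carr fun_eq_iff PiE_iff extensional_def)
  have lone: "left_translation G g \<one>\<^bsub>?A\<^esub> = \<one>\<^bsub>?A\<^esub>" if "g \<in> carrier G" for g
    using that by (auto simp: left_translation_def)
  note [simp del] = mult_sum_group one_sum_group inv_sum_group
  show ?thesis
  proof (rule groupI)
    fix x assume "x \<in> carrier (wreath_product H G)"
    then obtain f g where x: "x = (f, g)" "f \<in> carrier ?A" "g \<in> carrier G"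
      by (auto simp: wreath_product_def semidirect_product_def)
    show "\<exists>y\<in>carrier (wreath_product H G).
        y \<otimes>\<^bsub>wreath_product H G\<^esub> x = \<one>\<^bsub>wreath_product H G\<^esub>"
      using x
      by (intro bexI[of _ "(left_translation G (inv\<^bsub>G\<^esub> g) (inv\<^bsub>?A\<^esub> f), inv\<^bsub>G\<^esub> g)"])
        (auto simp: wreath_product_def semidirect_product_def closed lone mult[symmetric])
  qed (auto simp: wreath_product_def semidirect_product_def closed mult comp one A.m_assoc
        G.m_assoc)
qed

end

theory Submission
  imports Defs "HOL-Combinatorics.Transposition"
begin

text \<open>A nontrivial group \<open>H\<close> has two non-commuting actions \<open>a\<close>, \<open>b\<close> on \<open>H \<union> {\<infinity>}\<close>: left translation
  fixing \<open>\<infinity>\<close>, and its conjugate by the transposition of \<open>\<infinity>\<close> and \<open>1\<close>.  Given \<open>p \<in> G\<close>, let \<open>(f, g)\<close> act on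
  \<open>(H \<union> {\<infinity>}) \<times> G\<close> by \<open>(y, k) \<mapsto> (a (f (g k)) (b (f (g k p)) y), g k)\<close>.  This is not an action of
  \<open>H \<wr> G\<close>, as the copies of \<open>H\<close> at \<open>k\<close> and \<open>k p\<close> do not commute; but copies at positions
  not differing by \<open>p\<close> do.  Letting the free group act through its generators, a word of
  length \<open>n\<close> only involves supports of radius \<open>O(n)\<close>, so it acts like its value whenever \<open>p\<close> lies
  outside a ball of radius \<open>n + O(1)\<close>.  Hence \<open>N\<^sub>n\<close> acts trivially.  As \<open>G\<close> is infinite, \<open>p\<close> can be
  chosen at distance exactly \<open>n + O(1)\<close>, and then the commutator of the copies of \<open>H\<close> at \<open>1\<close> and \<open>p\<close>
  is a relator of length \<open>O(n)\<close> acting nontrivially.\<close>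

section \<open>Words and values\<close>

definition inv_word :: "'a letter list \<Rightarrow> 'a letter list" where
  "inv_word w = rev (map inv_letter w)"

lemma length_inv_word [simp]: "length (inv_word w) = length w"
  by (simp add: inv_word_def)

lemma inv_word_in_lists [intro]: "w \<in> lists (S \<times> UNIV) \<Longrightarrow> inv_word w \<in> lists (S \<times> UNIV)"
  by (auto simp: inv_word_def inv_letter_def in_lists_conv_set)

lemma length_reduced_Cons_le: "length (reduced_Cons x w) \<le> Suc (length w)"
  by (cases w) auto

lemma length_foldr_reduced_Cons_le: "length (foldr reduced_Cons u v) \<le> length u + length v"
proof (induction u)
  case (Cons x u)
  then show ?case
    using length_reduced_Cons_le[of x "foldr reduced_Cons u v"] by simp
qed simp

context group
begin

lemma eval_word_Nil [simp]: "eval_word G [] = \<one>"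
  by (simp add: eval_word_def)

lemma eval_word_Cons [simp]: "eval_word G (x # w) = eval_letter G x \<otimes> eval_word G w"
  by (simp add: eval_word_def)

lemma eval_word_append:
  assumes "u \<in> lists (S \<times> UNIV)" "v \<in> lists (S \<times> UNIV)" "S \<subseteq> carrier G"
  shows "eval_word G (u @ v) = eval_word G u \<otimes> eval_word G v"
  using assms(1)
proof (induction u)
  case Nil
  show ?case using assms eval_word_closed[of v S] by simp
next
  case (Cons x u)
  then show ?case
    using assms eval_word_closed[of v S] eval_word_closed[of u S] eval_letter_closed[of x S]
    by (simp add: m_assoc)
qed

lemma eval_letter_inv_letter:
  assumes "x \<in> S \<times> UNIV" "S \<subseteq> carrier G"
  shows "eval_letter G (inv_letter x) = inv (eval_letter G x)"
  using assms by (auto simp: eval_letter_def inv_letter_def)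

lemma eval_word_inv_word:
  assumes "w \<in> lists (S \<times> UNIV)" "S \<subseteq> carrier G"
  shows "eval_word G (inv_word w) = inv (eval_word G w)"
  using assms(1)
proof (induction w)
  case (Cons x w)
  have "eval_word G (inv_word (x # w)) = eval_word G (inv_word w) \<otimes> eval_word G [inv_letter x]"
    unfolding inv_word_def
    using Cons.hyps assms eval_word_append[of "inv_word w" S "[inv_letter x]"] inv_word_in_lists[of w S]
    by (simp add: inv_word_def)
  also have "\<dots> = inv (eval_letter G x \<otimes> eval_word G w)"
    using Cons assms eval_word_closed[of w S] eval_letter_closed[of x S]
    by (simp add: inv_mult_group eval_letter_inv_letter[of x S])
  finally show ?case by simp
qed (simp add: inv_word_def)

text \<open>\<open>foldr reduced_Cons u []\<close> is the free reduction of an arbitrary word, and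
  cancelling inverse pairs preserves the value. This allows relators to be built as unreduced words
  and reduced only at the end.\<close>

lemma eval_word_foldr_reduced_Cons:
  assumes "u \<in> lists (S \<times> UNIV)" "S \<subseteq> carrier G"
  shows "eval_word G (foldr reduced_Cons u []) = eval_word G u"
  using assms(1)
proof (induction u)
  case (Cons x u)
  then show ?case
    using assms foldr_in_lists[of u "S \<times> UNIV" "[]"] by (simp add: eval_word_reduced_Cons[of _ S])
qed simp

lemma generate_imp_eval_word:
  assumes "x \<in> generate G S" "S \<subseteq> carrier G"
  shows "\<exists>w\<in>lists (S \<times> UNIV). eval_word G w = x"
  using assms(1)
proof (induction rule: generate.induct)
  case one
  show ?case by (intro bexI[of _ "[]"]) auto
next
  case (incl h)
  then show ?case
    using assms by (intro bexI[of _ "[(h, True)]"]) (auto simp: eval_letter_def)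
next
  case (inv h)
  then show ?case
    using assms by (intro bexI[of _ "[(h, False)]"]) (auto simp: eval_letter_def)
next
  case (eng h1 h2)
  then obtain u v where "u \<in> lists (S \<times> UNIV)" "v \<in> lists (S \<times> UNIV)"
    "eval_word G u = h1" "eval_word G v = h2" by blast
  then show ?case
    using assms by (intro bexI[of _ "u @ v"]) (auto simp: eval_word_append[of _ S])
qed

lemma reduced_word_in_relators:
  assumes "w \<in> lists (S \<times> UNIV)" "S \<subseteq> carrier G" "eval_word G w = \<one>"
  shows "foldr reduced_Cons w [] \<in> relators G S"
  using assms foldr_in_lists[of w "S \<times> UNIV" "[]"] reduced_foldr[of "[]" w]
  by (simp add: relators_def kernel_def free_group_def eval_word_foldr_reduced_Cons[of _ S])

end

section \<open>Closures of short relators\<close>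

lemma short_relators_closure_mono:
  "m \<le> n \<Longrightarrow> short_relators_closure \<Gamma> S m \<subseteq> short_relators_closure \<Gamma> S n"
  by (fastforce simp: short_relators_closure_def normal_closure_def)

lemma short_relators_closure_leI:
  assumes "K \<lhd> free_group S" "\<And>w. w \<in> relators \<Gamma> S \<Longrightarrow> length w \<le> n \<Longrightarrow> w \<in> K"
  shows "short_relators_closure \<Gamma> S n \<subseteq> K"
  using assms by (auto simp: short_relators_closure_def normal_closure_def)

text \<open>The relator enters the increasing chain of closures at some first level, at most its own
  length, and the chain grows strictly there.\<close>

lemma relation_range_between:
  assumes "w \<in> relators \<Gamma> S" "w \<notin> short_relators_closure \<Gamma> S n"
  shows "\<exists>k\<in>relation_range \<Gamma> S. n < k \<and> k \<le> length w"
proof -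
  define k where "k = (LEAST k. w \<in> short_relators_closure \<Gamma> S k)"
  have mem: "w \<in> short_relators_closure \<Gamma> S (length w)"
    using assms(1) by (auto simp: short_relators_closure_def normal_closure_def)
  have k: "w \<in> short_relators_closure \<Gamma> S k" "k \<le> length w"
    unfolding k_def using mem by (auto intro: LeastI Least_le)
  have "n < k"
    using assms(2) k(1) short_relators_closure_mono[of k n \<Gamma> S] by (meson not_less subsetD)
  then obtain m where m: "k = Suc m" by (cases k) auto
  have "w \<notin> short_relators_closure \<Gamma> S m"
    using m not_less_Least[of m "\<lambda>k. w \<in> short_relators_closure \<Gamma> S k"] by (simp add: k_def)
  then have "k \<in> relation_range \<Gamma> S"
    using k(1) m short_relators_closure_mono[of m k \<Gamma> S] by (auto simp: relation_range_def)
  with \<open>n < k\<close> k show ?thesis by blast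
qed

section \<open>Wreath products\<close>

locale two_groups = H: group H + G: group G
  for H :: "('h, 'n) monoid_scheme" and G :: "('g, 'm) monoid_scheme"
begin

abbreviation W :: "(('g \<Rightarrow> 'h) \<times> 'g) monoid" where "W \<equiv> wreath_product H G"

sublocale W: group W
  by (rule group_wreath_product[OF H.is_group G.is_group])

definition base :: "('g \<Rightarrow> 'h) set" where
  "base = {f \<in> carrier G \<rightarrow>\<^sub>E carrier H. finite {x \<in> carrier G. f x \<noteq> \<one>\<^bsub>H\<^esub>}}"

text \<open>Members of the direct sum are extensional, so this function and \<open>single\<close>
  have to be restricted to the carrier.\<close>

definition triv :: "'g \<Rightarrow> 'h" where
  "triv = (\<lambda>x\<in>carrier G. \<one>\<^bsub>H\<^esub>)"

definition single :: "'g \<Rightarrow> 'h \<Rightarrow> 'g \<Rightarrow> 'h" where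
  "single x h = (\<lambda>y\<in>carrier G. if y = x then h else \<one>\<^bsub>H\<^esub>)"

lemma carrier_W: "carrier W = base \<times> carrier G"
  by (simp add: wreath_product_def semidirect_product_def base_def carrier_sum_group H.is_group)

lemma one_W: "\<one>\<^bsub>W\<^esub> = (triv, \<one>\<^bsub>G\<^esub>)"
  by (simp add: wreath_product_def semidirect_product_def triv_def)

lemma mult_W: "(f, g) \<otimes>\<^bsub>W\<^esub> (f', g') =
    ((\<lambda>x\<in>carrier G. f x \<otimes>\<^bsub>H\<^esub> left_translation G g f' x), g \<otimes>\<^bsub>G\<^esub> g')"
  by (simp add: wreath_product_def semidirect_product_def)

lemma snd_mult_W: "snd (x \<otimes>\<^bsub>W\<^esub> y) = snd x \<otimes>\<^bsub>G\<^esub> snd y"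
  by (cases x, cases y) (simp add: mult_W)

lemma fst_mult_W:
  "k \<in> carrier G \<Longrightarrow> fst (x \<otimes>\<^bsub>W\<^esub> y) k = fst x k \<otimes>\<^bsub>H\<^esub> fst y (inv\<^bsub>G\<^esub> (snd x) \<otimes>\<^bsub>G\<^esub> k)"
  by (cases x, cases y) (simp add: mult_W left_translation_def)

lemma snd_W_closed [simp]: "x \<in> carrier W \<Longrightarrow> snd x \<in> carrier G"
  by (auto simp: carrier_W)

lemma fst_W_closed [simp]: "x \<in> carrier W \<Longrightarrow> k \<in> carrier G \<Longrightarrow> fst x k \<in> carrier H"
  by (auto simp: carrier_W base_def)

lemma snd_hom: "snd \<in> hom W G"
  by (rule homI) (simp_all add: snd_mult_W)

lemma snd_inv_W: "x \<in> carrier W \<Longrightarrow> snd (inv\<^bsub>W\<^esub> x) = inv\<^bsub>G\<^esub> (snd x)"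
  using group_hom.hom_inv[of W G snd x] snd_hom
  by (simp add: group_hom_def group_hom_axioms_def W.is_group G.is_group)

lemma W_eqI:
  assumes "x \<in> carrier W" "y \<in> carrier W" "snd x = snd y"
    "\<And>k. k \<in> carrier G \<Longrightarrow> fst x k = fst y k"
  shows "x = y"
proof (rule prod_eqI)
  show "fst x = fst y"
    using assms by (intro PiE_ext[of "fst x" "carrier G" "\<lambda>_. carrier H"]) (auto simp: carrier_W base_def)
qed (rule assms(3))

lemma triv_base [simp]: "triv \<in> base"
  by (auto simp: base_def triv_def)

lemma single_base [simp]: "x \<in> carrier G \<Longrightarrow> h \<in> carrier H \<Longrightarrow> single x h \<in> base"
  by (auto simp: base_def single_def)

lemma triv_apply [simp]: "k \<in> carrier G \<Longrightarrow> triv k = \<one>\<^bsub>H\<^esub>"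
  by (simp add: triv_def)

lemma base_closed: "f \<in> base \<Longrightarrow> k \<in> carrier G \<Longrightarrow> f k \<in> carrier H"
  by (auto simp: base_def)

lemma single_apply: "k \<in> carrier G \<Longrightarrow> single x h k = (if k = x then h else \<one>\<^bsub>H\<^esub>)"
  by (simp add: single_def)

lemma finite_support: "x \<in> carrier W \<Longrightarrow> finite {k \<in> carrier G. fst x k \<noteq> \<one>\<^bsub>H\<^esub>}"
  by (auto simp: carrier_W base_def)

section \<open>Copies of \<open>H\<close> and \<open>G\<close> in the wreath product, and finite
  generation\<close>

lemma conj_single:
  assumes "g \<in> carrier G" "x \<in> carrier G" "h \<in> carrier H"
  shows "(triv, g) \<otimes>\<^bsub>W\<^esub> (single x h, \<one>\<^bsub>G\<^esub>) = (single (g \<otimes>\<^bsub>G\<^esub> x) h, \<one>\<^bsub>G\<^esub>) \<otimes>\<^bsub>W\<^esub> (triv, g)"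
proof (rule W_eqI)
  fix k assume k: "k \<in> carrier G"
  have "inv\<^bsub>G\<^esub> g \<otimes>\<^bsub>G\<^esub> k = x \<longleftrightarrow> k = g \<otimes>\<^bsub>G\<^esub> x"
    using assms k by (metis G.inv_closed G.inv_solve_left)
  then show "fst ((triv, g) \<otimes>\<^bsub>W\<^esub> (single x h, \<one>\<^bsub>G\<^esub>)) k =
      fst ((single (g \<otimes>\<^bsub>G\<^esub> x) h, \<one>\<^bsub>G\<^esub>) \<otimes>\<^bsub>W\<^esub> (triv, g)) k"
    using assms k by (auto simp: fst_mult_W single_apply)
next
  show "(triv, g) \<otimes>\<^bsub>W\<^esub> (single x h, \<one>\<^bsub>G\<^esub>) \<in> carrier W"
    "(single (g \<otimes>\<^bsub>G\<^esub> x) h, \<one>\<^bsub>G\<^esub>) \<otimes>\<^bsub>W\<^esub> (triv, g) \<in> carrier W"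
    by (rule W.m_closed; use assms in \<open>simp add: carrier_W\<close>)+
qed (use assms in \<open>simp add: snd_mult_W\<close>)

lemma single_commute:
  assumes "x \<in> carrier G" "y \<in> carrier G" "x \<noteq> y" "h \<in> carrier H" "h' \<in> carrier H"
  shows "(single x h, \<one>\<^bsub>G\<^esub>) \<otimes>\<^bsub>W\<^esub> (single y h', \<one>\<^bsub>G\<^esub>) =
    (single y h', \<one>\<^bsub>G\<^esub>) \<otimes>\<^bsub>W\<^esub> (single x h, \<one>\<^bsub>G\<^esub>)"
  using assms by (intro W_eqI W.m_closed) (auto simp: carrier_W snd_mult_W fst_mult_W single_apply)

lemma single_hom: "(\<lambda>h. (single \<one>\<^bsub>G\<^esub> h, \<one>\<^bsub>G\<^esub>)) \<in> hom H W"
proof (rule homI)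
  fix h h' assume "h \<in> carrier H" "h' \<in> carrier H"
  then show "(single \<one>\<^bsub>G\<^esub> (h \<otimes>\<^bsub>H\<^esub> h'), \<one>\<^bsub>G\<^esub>) =
      (single \<one>\<^bsub>G\<^esub> h, \<one>\<^bsub>G\<^esub>) \<otimes>\<^bsub>W\<^esub> (single \<one>\<^bsub>G\<^esub> h', \<one>\<^bsub>G\<^esub>)"
    by (intro W_eqI W.m_closed) (auto simp: carrier_W snd_mult_W fst_mult_W single_apply)
qed (simp add: carrier_W)

lemma triv_hom: "(\<lambda>g. (triv, g)) \<in> hom G W"
proof (rule homI)
  fix g g' assume "g \<in> carrier G" "g' \<in> carrier G"
  then show "(triv, g \<otimes>\<^bsub>G\<^esub> g') = (triv, g) \<otimes>\<^bsub>W\<^esub> (triv, g')"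
    by (intro W_eqI W.m_closed) (auto simp: carrier_W snd_mult_W fst_mult_W)
qed (simp add: carrier_W)

text \<open>Generators of \<open>H\<close> placed at position 1 and generators of \<open>G\<close>
  suffice: conjugation by \<open>G\<close> spreads the copy of \<open>H\<close> to every position,
  and products of these copies give all finitely supported functions.\<close>

lemma finitely_generated_W:
  assumes "finitely_generated_group H" "finitely_generated_group G"
  shows "finitely_generated_group W"
proof -
  let ?i = "\<lambda>h. (single \<one>\<^bsub>G\<^esub> h, \<one>\<^bsub>G\<^esub>)" and ?j = "\<lambda>g. (triv, g)"
  obtain A B where A: "finite A" "A \<subseteq> carrier H" "generate H A = carrier H"
    and B: "finite B" "B \<subseteq> carrier G" "generate G B = carrier G"
    using assms by (auto simp: finitely_generated_group_def generating_set_def)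
  define S where "S = ?i ` A \<union> ?j ` B"
  have S: "S \<subseteq> carrier W"
    using A B by (auto simp: S_def carrier_W)
  interpret i: group_hom H W ?i
    using single_hom by unfold_locales
  interpret j: group_hom G W ?j
    using triv_hom by unfold_locales
  interpret gen: subgroup "generate W S" W
    by (rule W.generate_is_subgroup[OF S])
  have i: "?i h \<in> generate W S" if "h \<in> carrier H" for h
    using i.generate_img[OF A(2)] A(3) that W.mono_generate[of "?i ` A" S] by (auto simp: S_def)
  have j: "?j g \<in> generate W S" if "g \<in> carrier G" for g
    using j.generate_img[OF B(2)] B(3) that W.mono_generate[of "?j ` B" S] by (auto simp: S_def)
  have single: "(single x h, \<one>\<^bsub>G\<^esub>) \<in> generate W S" if "x \<in> carrier G" "h \<in> carrier H" for x h
  proof -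
    have c: "?j x \<in> carrier W" "?i h \<in> carrier W" "(single x h, \<one>\<^bsub>G\<^esub>) \<in> carrier W"
      using that by (auto simp: carrier_W)
    have "(single x h, \<one>\<^bsub>G\<^esub>) = ?j x \<otimes>\<^bsub>W\<^esub> ?i h \<otimes>\<^bsub>W\<^esub> inv\<^bsub>W\<^esub> ?j x"
      using conj_single[of x "\<one>\<^bsub>G\<^esub>" h] that c by (simp add: W.m_assoc)
    then show ?thesis
      using i j that by simp
  qed
  have base: "(f, \<one>\<^bsub>G\<^esub>) \<in> generate W S" if "f \<in> base" for f
    using that
  \<comment> \<open>Induction on the size of the support: splitting off
    \<open>single x (f x)\<close> at a nontrivial entry leaves one entry fewer.\<close>
  proof (induction "card {x \<in> carrier G. f x \<noteq> \<one>\<^bsub>H\<^esub>}" arbitrary: f)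
    case 0
    then have "f = triv"
      by (intro PiE_ext[of f "carrier G" "\<lambda>_. carrier H"]) (auto simp: base_def triv_def)
    then show ?case by simp
  next
    case (Suc n)
    let ?supp = "\<lambda>f. {x \<in> carrier G. f x \<noteq> \<one>\<^bsub>H\<^esub>}"
    from Suc obtain x where x: "x \<in> carrier G" "f x \<noteq> \<one>\<^bsub>H\<^esub>"
      by (metis (mono_tags, lifting) card.empty empty_Collect_eq nat.distinct(1))
    define f' where "f' = f(x := \<one>\<^bsub>H\<^esub>)"
    have supp: "?supp f' = ?supp f - {x}"
      by (auto simp: f'_def)
    have f: "f \<in> carrier G \<rightarrow>\<^sub>E carrier H" "finite (?supp f)"
      using Suc.prems by (auto simp: base_def)
    then have f': "f' \<in> base"
      using x supp by (auto simp: base_def f'_def PiE_iff extensional_def)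
    have "n = card (?supp f')"
      unfolding supp using Suc.hyps(2) f x by simp
    then have "(f', \<one>\<^bsub>G\<^esub>) \<in> generate W S"
      using Suc.hyps(1) f' by blast
    moreover have "f x \<in> carrier H" using f x by auto
    moreover from this have "(f, \<one>\<^bsub>G\<^esub>) = (single x (f x), \<one>\<^bsub>G\<^esub>) \<otimes>\<^bsub>W\<^esub> (f', \<one>\<^bsub>G\<^esub>)"
      using f f' x Suc.prems
      by (intro W_eqI W.m_closed)
        (auto simp: carrier_W snd_mult_W fst_mult_W single_apply f'_def PiE_mem[OF f(1)])
    ultimately show ?case
      using single[of x "f x"] x by simp
  qed
  have "(f, g) \<in> generate W S" if "f \<in> base" "g \<in> carrier G" for f g
  proof -
    have "(f, g) = (f, \<one>\<^bsub>G\<^esub>) \<otimes>\<^bsub>W\<^esub> ?j g"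
      using that by (intro W_eqI W.m_closed) (auto simp: carrier_W snd_mult_W fst_mult_W base_closed[OF that(1)])
    also have "\<dots> \<in> generate W S"
      using gen.m_closed[OF base j] that .
    finally show ?thesis .
  qed
  then have "carrier W \<subseteq> generate W S"
    unfolding carrier_W by blast
  then have "generate W S = carrier W"
    using gen.subset by blast
  moreover have "finite S"
    using A B by (simp add: S_def)
  ultimately show ?thesis
    using S W.is_group unfolding finitely_generated_group_def generating_set_def by blast
qed

end

section \<open>Letterwise actions of free groups\<close>

text \<open>By the universal property of the free group it is enough that inverse letters undo each
  other; nothing is required of relators. As \<open>inv_letter\<close> is an involution, the
  one-sided cancellation law gives both sides.\<close>

locale letter_action =
  fixes S :: "'a set" and X :: "'x set" and act :: "'a letter \<Rightarrow> 'x \<Rightarrow> 'x"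
  assumes act_closed: "l \<in> S \<times> UNIV \<Longrightarrow> z \<in> X \<Longrightarrow> act l z \<in> X"
    and act_inv_letter: "l \<in> S \<times> UNIV \<Longrightarrow> z \<in> X \<Longrightarrow> act (inv_letter l) (act l z) = z"
begin

lemma foldr_act_closed: "w \<in> lists (S \<times> UNIV) \<Longrightarrow> z \<in> X \<Longrightarrow> foldr act w z \<in> X"
  by (induction w) (auto intro: act_closed)

lemma foldr_act_reduced_Cons:
  assumes "x \<in> S \<times> UNIV" "w \<in> lists (S \<times> UNIV)" "z \<in> X"
  shows "foldr act (reduced_Cons x w) z = act x (foldr act w z)"
proof (cases w)
  case (Cons y v)
  show ?thesis
  proof (cases "y = inv_letter x")
    case True
    then show ?thesis
      using Cons assms act_inv_letter[of y "foldr act v z"] foldr_act_closed[of v z] by simp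
  qed (simp add: Cons)
qed simp

lemma foldr_act_mult:
  assumes "u \<in> lists (S \<times> UNIV)" "v \<in> lists (S \<times> UNIV)" "z \<in> X"
  shows "foldr act (foldr reduced_Cons u v) z = foldr act u (foldr act v z)"
  using assms(1)
  by (induction u) (use assms foldr_in_lists[of _ "S \<times> UNIV" v] in \<open>simp_all add: foldr_act_reduced_Cons\<close>)

lemma foldr_act_inv_word:
  assumes "w \<in> lists (S \<times> UNIV)" "z \<in> X"
  shows "foldr act (inv_word w) (foldr act w z) = z"
  using assms
  by (induction w arbitrary: z) (simp_all add: inv_word_def act_inv_letter foldr_act_closed)

text \<open>These words form the kernel of the action of the free group on \<open>X\<close>. Being
  normal, it contains the normal closure of any set of words acting trivially.\<close>

lemma normal_fixing_words:
  "{w \<in> carrier (free_group S). \<forall>z\<in>X. foldr act w z = z} \<lhd> free_group S" (is "?K \<lhd> ?F")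
proof -
  interpret F: group ?F by (rule group_free_group)
  have lists: "w \<in> lists (S \<times> UNIV)" if "w \<in> carrier ?F" for w
    using that by (simp add: free_group_def)
  have mult: "foldr act (u \<otimes>\<^bsub>?F\<^esub> v) z = foldr act u (foldr act v z)"
    if "u \<in> carrier ?F" "v \<in> carrier ?F" "z \<in> X" for u v z
    using foldr_act_mult[OF lists[OF that(1)] lists[OF that(2)] that(3)] by (simp add: free_group_def)
  have one: "foldr act \<one>\<^bsub>?F\<^esub> z = z" for z
    by (simp add: free_group_def)
  have K: "w \<in> carrier ?F" "\<And>z. z \<in> X \<Longrightarrow> foldr act w z = z" if "w \<in> ?K" for w
    using that by auto
  have "subgroup ?K ?F"
  proof (rule F.subgroupI)
    show "?K \<subseteq> carrier ?F" by blast
    have "\<one>\<^bsub>?F\<^esub> \<in> ?K" using one by simp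
    then show "?K \<noteq> {}" by blast
  next
    fix u assume u: "u \<in> ?K"
    have "foldr act (inv\<^bsub>?F\<^esub> u) z = z" if z: "z \<in> X" for z
    proof -
      have "foldr act (inv\<^bsub>?F\<^esub> u) z = foldr act (inv\<^bsub>?F\<^esub> u) (foldr act u z)"
        using K[OF u] z by simp
      also have "\<dots> = foldr act (inv\<^bsub>?F\<^esub> u \<otimes>\<^bsub>?F\<^esub> u) z"
        using mult[of "inv\<^bsub>?F\<^esub> u" u z] K(1)[OF u] z by simp
      also have "\<dots> = z" using K(1)[OF u] one by simp
      finally show ?thesis .
    qed
    then show "inv\<^bsub>?F\<^esub> u \<in> ?K" using K(1)[OF u] by blast
  next
    fix u v assume u: "u \<in> ?K" and v: "v \<in> ?K"
    have "foldr act (u \<otimes>\<^bsub>?F\<^esub> v) z = z" if "z \<in> X" for z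
      using mult[OF K(1)[OF u] K(1)[OF v] that] K(2)[OF u that] K(2)[OF v that] by simp
    then show "u \<otimes>\<^bsub>?F\<^esub> v \<in> ?K" using K(1)[OF u] K(1)[OF v] by blast
  qed
  moreover have "x \<otimes>\<^bsub>?F\<^esub> u \<otimes>\<^bsub>?F\<^esub> inv\<^bsub>?F\<^esub> x \<in> ?K" if x: "x \<in> carrier ?F" and u: "u \<in> ?K" for x u
  proof -
    have ix: "inv\<^bsub>?F\<^esub> x \<in> carrier ?F" and xu: "x \<otimes>\<^bsub>?F\<^esub> u \<in> carrier ?F"
      using x K(1)[OF u] by auto
    have "foldr act (x \<otimes>\<^bsub>?F\<^esub> u \<otimes>\<^bsub>?F\<^esub> inv\<^bsub>?F\<^esub> x) z = z" if z: "z \<in> X" for z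
    proof -
      have z': "foldr act (inv\<^bsub>?F\<^esub> x) z \<in> X"
        by (rule foldr_act_closed[OF lists[OF ix] z])
      have "foldr act (x \<otimes>\<^bsub>?F\<^esub> u \<otimes>\<^bsub>?F\<^esub> inv\<^bsub>?F\<^esub> x) z = foldr act x (foldr act (inv\<^bsub>?F\<^esub> x) z)"
        unfolding mult[OF xu ix z] mult[OF x K(1)[OF u] z'] K(2)[OF u z'] ..
      also have "\<dots> = z"
        unfolding mult[OF x ix z, symmetric] F.r_inv[OF x] by (rule one)
      finally show ?thesis .
    qed
    then show ?thesis using xu ix by blast
  qed
  ultimately show ?thesis
    by (simp add: F.normal_inv_iff)
qed

end

section \<open>An action detecting one commutation relation\<close>

context two_groups
begin

text \<open>\<open>None\<close> is the point at infinity. The extra point gives non-commuting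
  actions even when \<open>H\<close> is abelian.\<close>

definition points :: "'h option set" where
  "points = insert None (Some ` carrier H)"

definition shift :: "'h \<Rightarrow> 'h option \<Rightarrow> 'h option" where
  "shift h = map_option (\<lambda>y. h \<otimes>\<^bsub>H\<^esub> y)"

text \<open>Being conjugate to \<open>shift\<close>, this is again an action of \<open>H\<close>. It
  fixes the identity of \<open>H\<close> and, for nontrivial \<open>h\<close>, moves
  \<open>None\<close> to \<open>Some h\<close>.\<close>

definition shift' :: "'h \<Rightarrow> 'h option \<Rightarrow> 'h option" where
  "shift' h y = transpose None (Some \<one>\<^bsub>H\<^esub>) (shift h (transpose None (Some \<one>\<^bsub>H\<^esub>) y))"

lemma transpose_points: "y \<in> points \<Longrightarrow> transpose None (Some \<one>\<^bsub>H\<^esub>) y \<in> points"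
  by (auto simp: transpose_def points_def)

lemma shift_points [simp]: "h \<in> carrier H \<Longrightarrow> y \<in> points \<Longrightarrow> shift h y \<in> points"
  by (auto simp: shift_def points_def)

lemma shift_one [simp]: "y \<in> points \<Longrightarrow> shift \<one>\<^bsub>H\<^esub> y = y"
  by (auto simp: shift_def points_def)

lemma shift_mult:
  "h \<in> carrier H \<Longrightarrow> h' \<in> carrier H \<Longrightarrow> y \<in> points \<Longrightarrow>
    shift (h \<otimes>\<^bsub>H\<^esub> h') y = shift h (shift h' y)"
  by (auto simp: shift_def points_def H.m_assoc)

lemma shift'_points [simp]: "h \<in> carrier H \<Longrightarrow> y \<in> points \<Longrightarrow> shift' h y \<in> points"
  unfolding shift'_def by (intro transpose_points shift_points)

lemma shift'_one [simp]: "y \<in> points \<Longrightarrow> shift' \<one>\<^bsub>H\<^esub> y = y"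
  using shift_one[OF transpose_points] by (simp add: shift'_def)

lemma shift'_mult:
  "h \<in> carrier H \<Longrightarrow> h' \<in> carrier H \<Longrightarrow> y \<in> points \<Longrightarrow>
    shift' (h \<otimes>\<^bsub>H\<^esub> h') y = shift' h (shift' h' y)"
  using shift_mult[OF _ _ transpose_points] by (simp add: shift'_def)

text \<open>Right multiplication by \<open>p\<close> commutes with left translation by
  \<open>G\<close>, so reading the entries at \<open>k\<close> and \<open>k p\<close> is
  equivariant; only the non-commutation of the two shifts can obstruct an action. Entries are read
  at the new position because \<open>(f, g)\<close> first moves by \<open>g\<close> and then applies
  \<open>f\<close>.\<close>

definition twist :: "'g \<Rightarrow> ('g \<Rightarrow> 'h) \<times> 'g \<Rightarrow> 'h option \<times> 'g \<Rightarrow> 'h option \<times> 'g" where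
  "twist p x z = (let k = snd x \<otimes>\<^bsub>G\<^esub> snd z in
     (shift (fst x k) (shift' (fst x (k \<otimes>\<^bsub>G\<^esub> p)) (fst z)), k))"

text \<open>The inverse bijection of \<open>twist p x\<close>, with the two shifts undone in reverse
  order. It need not be \<open>twist p\<close> of the inverse of \<open>x\<close>, since
  \<open>twist p\<close> is not multiplicative in general.\<close>

definition untwist :: "'g \<Rightarrow> ('g \<Rightarrow> 'h) \<times> 'g \<Rightarrow> 'h option \<times> 'g \<Rightarrow> 'h option \<times> 'g" where
  "untwist p x z = (let k = snd z in
     (shift' (inv\<^bsub>H\<^esub> fst x (k \<otimes>\<^bsub>G\<^esub> p)) (shift (inv\<^bsub>H\<^esub> fst x k) (fst z)), inv\<^bsub>G\<^esub> snd x \<otimes>\<^bsub>G\<^esub> k))"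

definition twist_letter ::
    "'g \<Rightarrow> (('g \<Rightarrow> 'h) \<times> 'g) letter \<Rightarrow> 'h option \<times> 'g \<Rightarrow> 'h option \<times> 'g" where
  "twist_letter p l = (if snd l then twist p (fst l) else untwist p (fst l))"

lemma twist_closed:
  assumes "p \<in> carrier G" "x \<in> carrier W" "z \<in> points \<times> carrier G"
  shows "twist p x z \<in> points \<times> carrier G"
  using assms by (auto simp: twist_def Let_def mem_Times_iff)

lemma untwist_closed:
  assumes "p \<in> carrier G" "x \<in> carrier W" "z \<in> points \<times> carrier G"
  shows "untwist p x z \<in> points \<times> carrier G"
  using assms by (auto simp: untwist_def Let_def mem_Times_iff)

lemma untwist_twist:
  assumes "p \<in> carrier G" "x \<in> carrier W" "z \<in> points \<times> carrier G"
  shows "untwist p x (twist p x z) = z"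
proof -
  obtain y k where z: "z = (y, k)" "y \<in> points" "k \<in> carrier G" using assms(3) by auto
  show ?thesis
    using assms z
    by (simp add: untwist_def twist_def Let_def shift_mult[symmetric] shift'_mult[symmetric]
        G.m_assoc[symmetric])
qed

lemma twist_untwist:
  assumes "p \<in> carrier G" "x \<in> carrier W" "z \<in> points \<times> carrier G"
  shows "twist p x (untwist p x z) = z"
proof -
  obtain y k where z: "z = (y, k)" "y \<in> points" "k \<in> carrier G" using assms(3) by auto
  show ?thesis
    using assms z
    by (simp add: untwist_def twist_def Let_def shift_mult[symmetric] shift'_mult[symmetric]
        G.m_assoc[symmetric])
qed

lemma twist_one:
  assumes "p \<in> carrier G" "z \<in> points \<times> carrier G"
  shows "twist p \<one>\<^bsub>W\<^esub> z = z"
  using assms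
  by (auto simp: twist_def one_W Let_def prod_eq_iff mem_Times_iff)

text \<open>Composing the two maps interleaves four shifts. Merging them only requires interchanging
  the \<open>shift\<close> coming from \<open>y\<close> with the \<open>shift'\<close> coming from
  \<open>x\<close>, and the last hypothesis makes one of these the identity.\<close>

lemma twist_mult:
  assumes p: "p \<in> carrier G" and x: "x \<in> carrier W" and y: "y \<in> carrier W"
    and z: "z \<in> points \<times> carrier G"
    and disjoint: "\<And>k. k \<in> carrier G \<Longrightarrow>
      fst x (k \<otimes>\<^bsub>G\<^esub> p) = \<one>\<^bsub>H\<^esub> \<or> fst y (inv\<^bsub>G\<^esub> snd x \<otimes>\<^bsub>G\<^esub> k) = \<one>\<^bsub>H\<^esub>"
  shows "twist p (x \<otimes>\<^bsub>W\<^esub> y) z = twist p x (twist p y z)"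
proof -
  obtain v k0 where zz: "z = (v, k0)" "v \<in> points" "k0 \<in> carrier G" using z by auto
  define k2 where "k2 = snd y \<otimes>\<^bsub>G\<^esub> k0"
  define k1 where "k1 = snd x \<otimes>\<^bsub>G\<^esub> k2"
  have k: "k1 \<in> carrier G" "k2 \<in> carrier G" "k1 \<otimes>\<^bsub>G\<^esub> p \<in> carrier G" "k2 \<otimes>\<^bsub>G\<^esub> p \<in> carrier G"
    using x y p zz by (auto simp: k1_def k2_def)
  have inv_k: "inv\<^bsub>G\<^esub> snd x \<otimes>\<^bsub>G\<^esub> k1 = k2" "inv\<^bsub>G\<^esub> snd x \<otimes>\<^bsub>G\<^esub> (k1 \<otimes>\<^bsub>G\<^esub> p) = k2 \<otimes>\<^bsub>G\<^esub> p"
    using x k p by (auto simp: k1_def G.m_assoc[symmetric])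
  have c: "fst x k1 \<in> carrier H" "fst x (k1 \<otimes>\<^bsub>G\<^esub> p) \<in> carrier H"
    "fst y k2 \<in> carrier H" "fst y (k2 \<otimes>\<^bsub>G\<^esub> p) \<in> carrier H"
    using x y k by auto
  have commute: "shift (fst y k2) (shift' (fst x (k1 \<otimes>\<^bsub>G\<^esub> p)) u) =
      shift' (fst x (k1 \<otimes>\<^bsub>G\<^esub> p)) (shift (fst y k2) u)" if u: "u \<in> points" for u
    using disjoint[OF k(1)] inv_k(1) c u
    by (auto simp:)
  have "twist p (x \<otimes>\<^bsub>W\<^esub> y) z = (shift (fst (x \<otimes>\<^bsub>W\<^esub> y) k1) (shift' (fst (x \<otimes>\<^bsub>W\<^esub> y) (k1 \<otimes>\<^bsub>G\<^esub> p)) v), k1)"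
    using x y zz by (simp add: twist_def Let_def snd_mult_W k1_def k2_def G.m_assoc)
  also have "\<dots> = (shift (fst x k1) (shift' (fst x (k1 \<otimes>\<^bsub>G\<^esub> p))
      (shift (fst y k2) (shift' (fst y (k2 \<otimes>\<^bsub>G\<^esub> p)) v))), k1)"
    using zz(2) c k
    by (simp add: fst_mult_W inv_k shift_mult shift'_mult commute)
  also have "\<dots> = twist p x (twist p y z)"
    using zz by (simp add: twist_def Let_def k1_def k2_def)
  finally show ?thesis .
qed

lemma letter_action_twist:
  assumes "p \<in> carrier G" "S \<subseteq> carrier W"
  shows "letter_action S (points \<times> carrier G) (twist_letter p)"
proof
  fix l :: "(('g \<Rightarrow> 'h) \<times> 'g) letter" and z assume l: "l \<in> S \<times> UNIV" and z: "z \<in> points \<times> carrier G"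
  have x: "fst l \<in> carrier W" using l assms by auto
  show "twist_letter p l z \<in> points \<times> carrier G"
    using twist_closed[OF assms(1) x z] untwist_closed[OF assms(1) x z] by (simp add: twist_letter_def)
  show "twist_letter p (inv_letter l) (twist_letter p l z) = z"
    using twist_untwist[OF assms(1) x z] untwist_twist[OF assms(1) x z]
    by (simp add: twist_letter_def inv_letter_def)
qed

end

section \<open>Balls and supports\<close>

text \<open>Takes the maximum of the individual bounds. It supplies a common support radius and a
  common word length for the finitely many letters.\<close>

lemma finite_uniform_bound:
  assumes "finite A" "\<And>x. x \<in> A \<Longrightarrow> \<exists>n::nat. P x n" "\<And>x m n. P x m \<Longrightarrow> m \<le> n \<Longrightarrow> P x n"
  shows "\<exists>n. \<forall>x\<in>A. P x n"
proof -
  obtain f where f: "\<And>x. x \<in> A \<Longrightarrow> P x (f x)"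
    using assms(2) by metis
  have "P x (Max (f ` A))" if "x \<in> A" for x
    using f[OF that] assms(1) that by (auto intro: assms(3))
  then show ?thesis by blast
qed

locale generated_wreath_product = two_groups H G
  for H :: "('h, 'n) monoid_scheme" and G :: "('g, 'm) monoid_scheme" +
  fixes S :: "(('g \<Rightarrow> 'h) \<times> 'g) set"
  assumes finite_S: "finite S" and generating: "generating_set W S"
begin

lemma S_subset: "S \<subseteq> carrier W"
  using generating by (simp add: generating_set_def)

lemma eval_word_surj: "x \<in> carrier W \<Longrightarrow> \<exists>w\<in>lists (S \<times> UNIV). eval_word W w = x"
  using W.generate_imp_eval_word[OF _ S_subset, of x] generating by (simp add: generating_set_def)

lemma eval_letter_W [simp]: "l \<in> S \<times> UNIV \<Longrightarrow> eval_letter W l \<in> carrier W"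
  by (rule W.eval_letter_closed[OF _ S_subset])

lemma eval_word_W [simp]: "w \<in> lists (S \<times> UNIV) \<Longrightarrow> eval_word W w \<in> carrier W"
  by (rule W.eval_word_closed[OF _ S_subset])

text \<open>The ball of \<open>G\<close> for the projections of the generators of the wreath
  product, so that radii in \<open>G\<close> and lengths of relators are counted in the same
  letters.\<close>

definition ball :: "nat \<Rightarrow> 'g set" where
  "ball n = (\<lambda>w. snd (eval_word W w)) ` {w \<in> lists (S \<times> UNIV). length w \<le> n}"

lemma ballI: "w \<in> lists (S \<times> UNIV) \<Longrightarrow> length w \<le> n \<Longrightarrow> snd (eval_word W w) \<in> ball n"
  by (auto simp: ball_def)

lemma ballE:
  assumes "x \<in> ball n"
  obtains w where "w \<in> lists (S \<times> UNIV)" "length w \<le> n" "x = snd (eval_word W w)"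
  using assms unfolding ball_def by blast

lemma ball_carrier: "x \<in> ball n \<Longrightarrow> x \<in> carrier G"
  by (erule ballE) simp

lemma finite_ball: "finite (ball n)"
proof -
  have "{w \<in> lists (S \<times> UNIV). length w \<le> n} = {w. set w \<subseteq> S \<times> (UNIV :: bool set) \<and> length w \<le> n}"
    by (auto simp: in_lists_conv_set)
  then show ?thesis
    using finite_lists_length_le[of "S \<times> (UNIV :: bool set)" n] finite_S by (simp add: ball_def)
qed

lemma ball_mono: "x \<in> ball m \<Longrightarrow> m \<le> n \<Longrightarrow> x \<in> ball n"
  by (erule ballE) (simp add: ballI)

lemma ball_mult:
  assumes "x \<in> ball m" "y \<in> ball n"
  shows "x \<otimes>\<^bsub>G\<^esub> y \<in> ball (m + n)"
proof -
  obtain u v where u: "u \<in> lists (S \<times> UNIV)" "length u \<le> m" "x = snd (eval_word W u)"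
    and v: "v \<in> lists (S \<times> UNIV)" "length v \<le> n" "y = snd (eval_word W v)"
    using assms by (elim ballE)
  have "x \<otimes>\<^bsub>G\<^esub> y = snd (eval_word W (u @ v))"
    using W.eval_word_append[OF u(1) v(1) S_subset] u v by (simp add: snd_mult_W)
  then show ?thesis
    using u v ballI[of "u @ v" "m + n"] by simp
qed

lemma ball_inv:
  assumes "x \<in> ball n"
  shows "inv\<^bsub>G\<^esub> x \<in> ball n"
proof -
  obtain w where w: "w \<in> lists (S \<times> UNIV)" "length w \<le> n" "x = snd (eval_word W w)"
    using assms by (rule ballE)
  then have "inv\<^bsub>G\<^esub> x = snd (eval_word W (inv_word w))"
    using W.eval_word_inv_word[OF w(1) S_subset] by (simp add: snd_inv_W)
  then show ?thesis
    using w ballI[OF inv_word_in_lists[OF w(1)], of n] by simp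
qed

lemma ball_letter: "l \<in> S \<times> UNIV \<Longrightarrow> snd (eval_letter W l) \<in> ball 1"
  using ballI[of "[l]" 1] by simp

lemma ball_cover:
  assumes "x \<in> carrier G"
  shows "\<exists>n. x \<in> ball n"
proof -
  obtain w where "w \<in> lists (S \<times> UNIV)" "eval_word W w = (triv, x)"
    using eval_word_surj[of "(triv, x)"] assms by (auto simp: carrier_W)
  then show ?thesis
    using ballI[of w "length w"] by auto
qed

lemma ball_Suc:
  assumes "x \<in> ball (Suc n)"
  shows "x \<in> ball n \<or> (\<exists>y\<in>ball 1. \<exists>z\<in>ball n. x = y \<otimes>\<^bsub>G\<^esub> z)"
proof -
  obtain w where w: "w \<in> lists (S \<times> UNIV)" "length w \<le> Suc n" "x = snd (eval_word W w)"
    using assms by (rule ballE)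
  show ?thesis
  proof (cases w)
    case Nil
    then show ?thesis using w ballI[of w n] by simp
  next
    case (Cons l v)
    then have "x = snd (eval_letter W l) \<otimes>\<^bsub>G\<^esub> snd (eval_word W v)"
      using w by (simp add: snd_mult_W)
    then show ?thesis
      using Cons w ball_letter[of l] ballI[of v n] by auto
  qed
qed

text \<open>If two successive balls coincided, the smaller one would absorb left multiplication by
  single letters and hence be all of \<open>G\<close>; but balls are finite.\<close>

lemma ball_strict:
  assumes "infinite (carrier G)"
  shows "\<exists>p\<in>ball (Suc n). p \<notin> ball n"
proof (rule ccontr)
  assume "\<not> ?thesis"
  then have step: "\<And>x. x \<in> ball (Suc n) \<Longrightarrow> x \<in> ball n" by blast
  have "x \<in> ball m \<Longrightarrow> x \<in> ball n" for x m
  proof (induction m arbitrary: x)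
    case 0
    then show ?case using ball_mono[of x 0 n] by simp
  next
    case (Suc m)
    have "y \<otimes>\<^bsub>G\<^esub> z \<in> ball n" if "y \<in> ball 1" "z \<in> ball m" for y z
      using ball_mult[OF that(1) Suc.IH[OF that(2)]] step by simp
    then show ?case
      using ball_Suc[OF Suc.prems] Suc.IH by blast
  qed
  then have "carrier G \<subseteq> ball n" using ball_cover by blast
  then show False using assms finite_ball finite_subset by blast
qed

lemma support_radius:
  "\<exists>r. \<forall>l\<in>S \<times> UNIV. \<forall>k\<in>carrier G. fst (eval_letter W l) k \<noteq> \<one>\<^bsub>H\<^esub> \<longrightarrow> k \<in> ball r"
proof -
  let ?F = "\<Union>l\<in>S \<times> UNIV. {k \<in> carrier G. fst (eval_letter W l) k \<noteq> \<one>\<^bsub>H\<^esub>}"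
  have "finite ?F"
    using finite_S by (intro finite_UN_I finite_support eval_letter_W finite_cartesian_product) auto
  then have "\<exists>r. \<forall>k\<in>?F. k \<in> ball r"
  proof (rule finite_uniform_bound)
    fix k assume "k \<in> ?F"
    then show "\<exists>n. k \<in> ball n" by (intro ball_cover) blast
  qed (rule ball_mono)
  then obtain r where "\<forall>k\<in>?F. k \<in> ball r" ..
  then show ?thesis by (intro exI[of _ r]) blast
qed

end

section \<open>Words acting like their values when \<open>p\<close> is far from the identity\<close>

locale bounded_wreath_product = generated_wreath_product H G S
  for H :: "('h, 'n) monoid_scheme" and G :: "('g, 'm) monoid_scheme" and S +
  fixes r :: nat
  assumes letter_support: "l \<in> S \<times> UNIV \<Longrightarrow> k \<in> carrier G \<Longrightarrow>
    fst (eval_letter W l) k \<noteq> \<one>\<^bsub>H\<^esub> \<Longrightarrow> k \<in> ball r"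
begin

text \<open>The support of a product lies in that of the first factor joined with a translate of
  that of the second. A letter contributes within radius \<open>r\<close> and translates by at most
  1.\<close>

lemma word_support:
  assumes "w \<in> lists (S \<times> UNIV)" "k \<in> carrier G" "fst (eval_word W w) k \<noteq> \<one>\<^bsub>H\<^esub>"
  shows "k \<in> ball (length w + r)"
  using assms
proof (induction w arbitrary: k)
  case Nil
  then show ?case by (simp add: one_W)
next
  case (Cons l w)
  let ?g = "snd (eval_letter W l)"
  have l: "l \<in> S \<times> UNIV" and g: "?g \<in> carrier G"
    using Cons.hyps by auto
  show ?case
  proof (cases "fst (eval_letter W l) k = \<one>\<^bsub>H\<^esub>")
    case True
    then have "fst (eval_word W w) (inv\<^bsub>G\<^esub> ?g \<otimes>\<^bsub>G\<^esub> k) \<noteq> \<one>\<^bsub>H\<^esub>"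
      using Cons.prems by (auto simp: fst_mult_W)
    then have "inv\<^bsub>G\<^esub> ?g \<otimes>\<^bsub>G\<^esub> k \<in> ball (length w + r)"
      using Cons.IH[of "inv\<^bsub>G\<^esub> ?g \<otimes>\<^bsub>G\<^esub> k"] Cons.prems g by simp
    from ball_mult[OF ball_letter[OF l] this] show ?thesis
      using g Cons.prems by (simp add: G.m_assoc[symmetric])
  next
    case False
    then show ?thesis
      using letter_support[OF l Cons.prems(1)] ball_mono by auto
  qed
qed

lemma twist_Cons:
  assumes p: "p \<in> carrier G" "p \<notin> ball (2 * r + Suc (length w))"
    and l: "l \<in> S \<times> UNIV" and w: "w \<in> lists (S \<times> UNIV)" and z: "z \<in> points \<times> carrier G"
  shows "twist p (eval_word W (l # w)) z = twist p (eval_letter W l) (twist p (eval_word W w) z)"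
  unfolding W.eval_word_Cons
proof (rule twist_mult)
  fix k assume k: "k \<in> carrier G"
  let ?g = "snd (eval_letter W l)"
  have g: "?g \<in> carrier G" using l by simp
  show "fst (eval_letter W l) (k \<otimes>\<^bsub>G\<^esub> p) = \<one>\<^bsub>H\<^esub> \<or>
      fst (eval_word W w) (inv\<^bsub>G\<^esub> ?g \<otimes>\<^bsub>G\<^esub> k) = \<one>\<^bsub>H\<^esub>"
  proof (rule ccontr)
    assume "\<not> ?thesis"
    then have a: "k \<otimes>\<^bsub>G\<^esub> p \<in> ball r" and b: "inv\<^bsub>G\<^esub> ?g \<otimes>\<^bsub>G\<^esub> k \<in> ball (length w + r)"
      using letter_support[OF l, of "k \<otimes>\<^bsub>G\<^esub> p"] word_support[OF w, of "inv\<^bsub>G\<^esub> ?g \<otimes>\<^bsub>G\<^esub> k"] k p g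
      by auto
    \<comment> \<open>This explains the radius in the hypothesis: \<open>p\<close> is the inverse of
      \<open>k\<close> times \<open>k p\<close>, and these have radii
      \<open>1 + (length w + r)\<close> and \<open>r\<close>.\<close>
    have "k \<in> ball (1 + (length w + r))"
      using ball_mult[OF ball_letter[OF l] b] g k by (simp add: G.m_assoc[symmetric])
    from ball_mult[OF ball_inv[OF this] a]
    have "p \<in> ball (1 + (length w + r) + r)"
      using k p by (simp add: G.m_assoc[symmetric])
    moreover have "1 + (length w + r) + r = 2 * r + Suc (length w)" by simp
    ultimately show False using p(2) by (simp only: not_True_eq_False)
  qed
qed (use assms in auto)

lemma twist_letter_eq:
  assumes p: "p \<in> carrier G" "p \<notin> ball (2 * r + 2)"
    and l: "l \<in> S \<times> UNIV" and z: "z \<in> points \<times> carrier G"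
  shows "twist_letter p l z = twist p (eval_letter W l) z"
proof (cases "snd l")
  case True
  then show ?thesis by (simp add: twist_letter_def eval_letter_def)
next
  case False
  define s where "s = fst l"
  have s: "s \<in> S" "s \<in> carrier W" and l_eq: "l = (s, False)"
    using l S_subset False by (auto simp: s_def prod_eq_iff)
  \<comment> \<open>The word made of \<open>s\<close> and its inverse has value 1, and its tail
    \<open>[l]\<close> has length 1, whence the radius \<open>2 * r + 2\<close>. So
    \<open>twist p\<close> of the inverse is a right inverse of \<open>twist p s\<close>, as
    \<open>untwist p s\<close> is.\<close>
  have "twist p s (twist p (inv\<^bsub>W\<^esub> s) z) = z"
    using twist_Cons[of p "[l]" "(s, True)" z] p s l z
    by (simp add: l_eq eval_letter_def twist_one)
  then show ?thesis
    using untwist_twist[OF p(1) s(2) twist_closed[OF p(1) W.inv_closed[OF s(2)] z]] l_eq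
    by (simp add: twist_letter_def eval_letter_def)
qed

text \<open>Multiplicativity is applied one letter at a time. The radius dominates both the one in
  \<open>twist_Cons\<close>, for every tail, and the one in \<open>twist_letter_eq\<close>.\<close>

lemma foldr_twist_letter:
  assumes p: "p \<in> carrier G" "p \<notin> ball (2 * r + length w + 2)"
    and w: "w \<in> lists (S \<times> UNIV)" and z: "z \<in> points \<times> carrier G"
  shows "foldr (twist_letter p) w z = twist p (eval_word W w) z"
  using w p(2)
proof (induction w)
  case Nil
  then show ?case using p z by (simp add: twist_one)
next
  case (Cons l w)
  have "foldr (twist_letter p) w z = twist p (eval_word W w) z"
    using Cons ball_mono[of p "2 * r + length w + 2" "2 * r + length (l # w) + 2"] by auto
  moreover have "twist_letter p l (twist p (eval_word W w) z) =
      twist p (eval_letter W l) (twist p (eval_word W w) z)"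
    using Cons p z ball_mono[of p "2 * r + 2"] by (intro twist_letter_eq twist_closed) auto
  moreover have "p \<notin> ball (2 * r + Suc (length w))"
    using Cons.prems ball_mono[of p "2 * r + Suc (length w)" "2 * r + length (l # w) + 2"] by auto
  ultimately show ?case
    using twist_Cons[of p w l z] Cons p z by simp
qed

text \<open>A relator of length at most \<open>n\<close> acts like its value, the identity, so it
  lies in the kernel of the action, which is normal.\<close>

lemma short_relators_closure_fixes:
  assumes p: "p \<in> carrier G" "p \<notin> ball (2 * r + n + 2)"
    and w: "w \<in> short_relators_closure W S n" and z: "z \<in> points \<times> carrier G"
  shows "foldr (twist_letter p) w z = z"
proof -
  interpret letter_action S "points \<times> carrier G" "twist_letter p"
    by (rule letter_action_twist[OF p(1) S_subset])
  let ?K = "{w \<in> carrier (free_group S). \<forall>z\<in>points \<times> carrier G. foldr (twist_letter p) w z = z}"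
  have "short_relators_closure W S n \<subseteq> ?K"
  proof (rule short_relators_closure_leI[OF normal_fixing_words])
    fix u assume u: "u \<in> relators W S" "length u \<le> n"
    then have u': "u \<in> carrier (free_group S)" "u \<in> lists (S \<times> UNIV)" "eval_word W u = \<one>\<^bsub>W\<^esub>"
      by (auto simp: relators_def kernel_def free_group_def)
    have "p \<notin> ball (2 * r + length u + 2)"
      using p(2) u(2) ball_mono[of p "2 * r + length u + 2" "2 * r + n + 2"] by auto
    then show "u \<in> ?K"
      using u' p(1) by (auto simp: foldr_twist_letter twist_one)
  qed
  then show ?thesis using w z by blast
qed

text \<open>Replacing each letter by such a word turns a word projecting to \<open>q\<close> into a
  word for the pure translation \<open>(triv, q)\<close>, at the cost of a constant factor in
  length.\<close>

lemma pure_words: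
  "\<exists>L. \<forall>l\<in>S \<times> UNIV. \<exists>w\<in>lists (S \<times> UNIV). length w \<le> L \<and> eval_word W w = (triv, snd (eval_letter W l))"
proof (rule finite_uniform_bound)
  fix l assume "l \<in> S \<times> (UNIV :: bool set)"
  then have "snd (eval_letter W l) \<in> carrier G" by simp
  then have "(triv, snd (eval_letter W l)) \<in> carrier W"
    by (simp add: carrier_W)
  from eval_word_surj[OF this]
  show "\<exists>n. \<exists>w\<in>lists (S \<times> UNIV). length w \<le> n \<and> eval_word W w = (triv, snd (eval_letter W l))"
    by blast
qed (use finite_S in \<open>auto intro: order_trans\<close>)

section \<open>Long relators\<close>

lemma twist_pure:
  "g \<in> carrier G \<Longrightarrow> p \<in> carrier G \<Longrightarrow> z \<in> points \<times> carrier G \<Longrightarrow>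
    twist p (triv, g) z = (fst z, g \<otimes>\<^bsub>G\<^esub> snd z)"
  by (auto simp: twist_def Let_def)

text \<open>The word \<open>v\<close> may be too long, compared with the distance of
  \<open>p\<close> from the identity, for \<open>foldr_twist_letter\<close> to apply to it as a
  whole. It is built from blocks of length at most \<open>L\<close>, each acting exactly as a
  translation of the \<open>G\<close>-coordinate, and translations compose. Thus \<open>p\<close>
  only has to avoid a ball of fixed radius.\<close>

lemma pure_word_exists:
  assumes L: "\<And>l. l \<in> S \<times> UNIV \<Longrightarrow>
      \<exists>w\<in>lists (S \<times> UNIV). length w \<le> L \<and> eval_word W w = (triv, snd (eval_letter W l))"
    and p: "p \<in> carrier G" "p \<notin> ball (2 * r + L + 2)" and q: "q \<in> ball n"
  shows "\<exists>v\<in>lists (S \<times> UNIV). length v \<le> L * n \<and> eval_word W v = (triv, q) \<and>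
    (\<forall>z\<in>points \<times> carrier G. foldr (twist_letter p) v z = (fst z, q \<otimes>\<^bsub>G\<^esub> snd z))"
proof -
  have step: "\<exists>v\<in>lists (S \<times> UNIV). length v \<le> L * length u \<and> eval_word W v = (triv, snd (eval_word W u)) \<and>
    (\<forall>z\<in>points \<times> carrier G. foldr (twist_letter p) v z = (fst z, snd (eval_word W u) \<otimes>\<^bsub>G\<^esub> snd z))"
    if "u \<in> lists (S \<times> UNIV)" for u
    using that
  proof (induction u)
    case Nil
    show ?case by (intro bexI[of _ "[]"]) (auto simp: one_W)
  next
    case (Cons l u)
    let ?g = "snd (eval_letter W l)" and ?q = "snd (eval_word W u)"
    have g: "?g \<in> carrier G" "?q \<in> carrier G" using Cons.hyps by simp_all
    obtain v where v: "v \<in> lists (S \<times> UNIV)" "length v \<le> L * length u" "eval_word W v = (triv, ?q)"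
      "\<And>z. z \<in> points \<times> carrier G \<Longrightarrow> foldr (twist_letter p) v z = (fst z, ?q \<otimes>\<^bsub>G\<^esub> snd z)"
      using Cons.IH by blast
    obtain w where w: "w \<in> lists (S \<times> UNIV)" "length w \<le> L" "eval_word W w = (triv, ?g)"
      using L[OF Cons.hyps(1)] by blast
    have p': "p \<notin> ball (2 * r + length w + 2)"
      using p(2) w(2) ball_mono[of p "2 * r + length w + 2" "2 * r + L + 2"] by auto
    have "eval_word W (w @ v) = (triv, ?g \<otimes>\<^bsub>G\<^esub> ?q)"
      using W.eval_word_append[OF w(1) v(1) S_subset] w v hom_mult[OF triv_hom g] by simp
    moreover have "foldr (twist_letter p) (w @ v) z = (fst z, ?g \<otimes>\<^bsub>G\<^esub> ?q \<otimes>\<^bsub>G\<^esub> snd z)"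
      if "z \<in> points \<times> carrier G" for z
    proof -
      have z: "(fst z, ?q \<otimes>\<^bsub>G\<^esub> snd z) \<in> points \<times> carrier G" using that g by auto
      have "foldr (twist_letter p) (w @ v) z = twist p (triv, ?g) (fst z, ?q \<otimes>\<^bsub>G\<^esub> snd z)"
        using foldr_twist_letter[OF p(1) p' w(1) z] v(4)[OF that] w(3) by simp
      also have "\<dots> = (fst z, ?g \<otimes>\<^bsub>G\<^esub> (?q \<otimes>\<^bsub>G\<^esub> snd z))"
        using twist_pure[OF g(1) p(1) z] by simp
      finally show ?thesis using g that by (simp add: G.m_assoc mem_Times_iff)
    qed
    ultimately show ?case
      using v(1,2) w(1,2) by (intro bexI[of _ "w @ v"]) (auto simp: snd_mult_W)
  qed
  obtain u where u: "u \<in> lists (S \<times> UNIV)" "length u \<le> n" "q = snd (eval_word W u)"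
    using q by (rule ballE)
  have "L * length u \<le> L * n" using u(2) by simp
  then show ?thesis using step[OF u(1)] u(3) order_trans by blast
qed

lemma long_relator:
  assumes "infinite (carrier G)" and h: "h \<in> carrier H" "h \<noteq> \<one>\<^bsub>H\<^esub>"
  shows "\<exists>C. \<forall>n\<ge>1. \<exists>w\<in>relators W S. length w \<le> C * n \<and> w \<notin> short_relators_closure W S n"
proof -
  obtain L where L: "\<And>l. l \<in> S \<times> UNIV \<Longrightarrow>
      \<exists>w\<in>lists (S \<times> UNIV). length w \<le> L \<and> eval_word W w = (triv, snd (eval_letter W l))"
    using pure_words by blast
  have "(single \<one>\<^bsub>G\<^esub> h, \<one>\<^bsub>G\<^esub>) \<in> carrier W" using h by (simp add: carrier_W)
  then obtain u where u: "u \<in> lists (S \<times> UNIV)" "eval_word W u = (single \<one>\<^bsub>G\<^esub> h, \<one>\<^bsub>G\<^esub>)"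
    using eval_word_surj by blast
  \<comment> \<open>Chosen so that \<open>c + n\<close> dominates the radii needed for the blocks of
    \<open>v\<close>, for \<open>u\<close>, and for relators of length at most
    \<open>n\<close>.\<close>
  define c where "c = 2 * r + L + length u + 2"
  have "\<exists>w\<in>relators W S. length w \<le> 4 * (length u + L * (c + 2)) * n \<and> w \<notin> short_relators_closure W S n"
    if n: "n \<ge> 1" for n
  proof -
    \<comment> \<open>Taking \<open>p\<close> just outside the excluded ball keeps the length of its
      word \<open>v\<close> linear in \<open>n\<close>.\<close>
    obtain p where p: "p \<in> ball (Suc (c + n))" "p \<notin> ball (c + n)"
      using ball_strict[OF assms(1)] by blast
    have pG: "p \<in> carrier G" using p(1) by (rule ball_carrier)
    have far: "p \<notin> ball m" if "m \<le> c + n" for m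
      using p(2) that ball_mono by blast
    have "p \<notin> ball (2 * r + L + 2)" by (rule far) (simp add: c_def)
    then obtain v where v: "v \<in> lists (S \<times> UNIV)" "length v \<le> L * Suc (c + n)" "eval_word W v = (triv, p)"
      "\<And>z. z \<in> points \<times> carrier G \<Longrightarrow> foldr (twist_letter p) v z = (fst z, p \<otimes>\<^bsub>G\<^esub> snd z)"
      using pure_word_exists[OF L pG _ p(1)] by blast
    interpret letter_action S "points \<times> carrier G" "twist_letter p"
      by (rule letter_action_twist[OF pG S_subset])
    let ?act = "foldr (twist_letter p)"
    \<comment> \<open>\<open>P\<close> and \<open>Q\<close> multiply the copies of \<open>h\<close>
      at 1 and at \<open>p\<close> in the two orders, with \<open>v u v^-1\<close> representing the
      copy at \<open>p\<close>; \<open>R\<close> represents their commutator.\<close>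
    define P where "P = u @ v @ u @ inv_word v"
    define Q where "Q = v @ u @ inv_word v @ u"
    define R where "R = P @ inv_word Q"
    have iv: "inv_word v \<in> lists (S \<times> UNIV)" using v(1) by (rule inv_word_in_lists)
    have PQ': "P \<in> lists (S \<times> UNIV)" "Q \<in> lists (S \<times> UNIV)"
      using u(1) v(1) iv by (auto simp: P_def Q_def)
    note PQ = PQ' inv_word_in_lists[OF PQ'(2)]
    then have R: "R \<in> lists (S \<times> UNIV)" by (simp add: R_def)
    have p_ne: "p \<noteq> \<one>\<^bsub>G\<^esub>"
      using far[of 0] ballI[of "[]" 0] by (auto simp: one_W)

    let ?a = "(single \<one>\<^bsub>G\<^esub> h, \<one>\<^bsub>G\<^esub>)" and ?b = "(single p h, \<one>\<^bsub>G\<^esub>)" and ?t = "(triv, p)"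
    have carr: "?a \<in> carrier W" "?b \<in> carrier W" "?t \<in> carrier W"
      using h pG by (auto simp: carrier_W)
    have "?t \<otimes>\<^bsub>W\<^esub> ?a = ?b \<otimes>\<^bsub>W\<^esub> ?t"
      using conj_single[OF pG G.one_closed h(1)] pG by simp
    then have conj: "?t \<otimes>\<^bsub>W\<^esub> (?a \<otimes>\<^bsub>W\<^esub> inv\<^bsub>W\<^esub> ?t) = ?b"
      using carr by (simp add: W.m_assoc[symmetric]) (simp add: W.m_assoc)
    have comm: "?a \<otimes>\<^bsub>W\<^esub> ?b = ?b \<otimes>\<^bsub>W\<^esub> ?a"
      using single_commute[of "\<one>\<^bsub>G\<^esub>" p h h] pG p_ne h by simp
    note app = W.eval_word_append[OF _ _ S_subset]
    have "eval_word W P = ?a \<otimes>\<^bsub>W\<^esub> ?b"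
      using u v iv conj by (simp add: P_def app W.eval_word_inv_word[OF _ S_subset])
    moreover have "eval_word W Q = ?b \<otimes>\<^bsub>W\<^esub> ?a"
    proof -
      have "eval_word W Q = ?t \<otimes>\<^bsub>W\<^esub> (?a \<otimes>\<^bsub>W\<^esub> (inv\<^bsub>W\<^esub> ?t \<otimes>\<^bsub>W\<^esub> ?a))"
        using u v iv by (simp add: Q_def app W.eval_word_inv_word[OF _ S_subset])
      also have "\<dots> = ?t \<otimes>\<^bsub>W\<^esub> (?a \<otimes>\<^bsub>W\<^esub> inv\<^bsub>W\<^esub> ?t) \<otimes>\<^bsub>W\<^esub> ?a"
        using carr by (simp add: W.m_assoc)
      finally show ?thesis by (simp only: conj)
    qed
    ultimately have "eval_word W R = \<one>\<^bsub>W\<^esub>"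
      using PQ comm carr
      by (simp add: R_def app W.eval_word_inv_word[OF _ S_subset])
    then have rel: "foldr reduced_Cons R [] \<in> relators W S"
      by (rule W.reduced_word_in_relators[OF R S_subset])

    have act_u: "?act u (y, k) = (shift (single \<one>\<^bsub>G\<^esub> h k) (shift' (single \<one>\<^bsub>G\<^esub> h (k \<otimes>\<^bsub>G\<^esub> p)) y), k)"
      if "y \<in> points" "k \<in> carrier G" for y k
    proof -
      have "p \<notin> ball (2 * r + length u + 2)" by (rule far) (simp add: c_def)
      then show ?thesis
        using foldr_twist_letter[OF pG _ u(1), of "(y, k)"] u(2) that by (simp add: twist_def)
    qed
    have act_iv: "?act (inv_word v) (y, p \<otimes>\<^bsub>G\<^esub> k) = (y, k)" if "y \<in> points" "k \<in> carrier G" for y k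
      using foldr_act_inv_word[OF v(1), of "(y, k)"] v(4)[of "(y, k)"] that by simp
    have pt: "None \<in> points" "Some h \<in> points"
      using h by (auto simp: points_def)
    have sh: "shift h None = None" "shift h (Some h) = Some (h \<otimes>\<^bsub>H\<^esub> h)" "shift' h None = Some h"
      using h by (auto simp: shift_def shift'_def transpose_def)
    have ip: "inv\<^bsub>G\<^esub> p \<in> carrier G" "inv\<^bsub>G\<^esub> p \<noteq> \<one>\<^bsub>G\<^esub>"
      using pG p_ne by (simp_all add: G.inv_eq_1_iff)
    \<comment> \<open>The value of \<open>u\<close> has its only nontrivial entry at 1. Over
      position 1 this entry is read by \<open>shift\<close>, over the inverse of \<open>p\<close> by
      \<open>shift'\<close>; as \<open>p\<close> is not 1, the other factor is trivial in each
      case.\<close>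
    have u1: "?act u (y, \<one>\<^bsub>G\<^esub>) = (shift h y, \<one>\<^bsub>G\<^esub>)"
      and up: "?act u (y, inv\<^bsub>G\<^esub> p) = (shift' h y, inv\<^bsub>G\<^esub> p)" if "y \<in> points" for y
      using act_u[OF that] that pG ip p_ne h by (simp_all add: single_apply)
    \<comment> \<open>\<open>v\<close> carries the fibre over the inverse of \<open>p\<close> to the
      fibre over 1, so \<open>v u v^-1\<close> acts on the latter by
      \<open>shift' h\<close>.\<close>
    have v1: "?act v (y, inv\<^bsub>G\<^esub> p) = (y, \<one>\<^bsub>G\<^esub>)"
      and iv1: "?act (inv_word v) (y, \<one>\<^bsub>G\<^esub>) = (y, inv\<^bsub>G\<^esub> p)" if "y \<in> points" for y
      using v(4)[of "(y, inv\<^bsub>G\<^esub> p)"] act_iv[OF that ip(1)] that pG by simp_all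
    \<comment> \<open>Starting from infinity, \<open>shift h\<close> after \<open>shift' h\<close>
      gives \<open>h h\<close>, while the opposite order gives \<open>h\<close>.\<close>
    have "?act P (None, \<one>\<^bsub>G\<^esub>) = (Some (h \<otimes>\<^bsub>H\<^esub> h), \<one>\<^bsub>G\<^esub>)"
      using pt by (simp add: P_def iv1 up v1 u1 sh)
    moreover have "?act Q (None, \<one>\<^bsub>G\<^esub>) = (Some h, \<one>\<^bsub>G\<^esub>)"
      using pt by (simp add: Q_def iv1 up v1 u1 sh)
    moreover have "h \<otimes>\<^bsub>H\<^esub> h \<noteq> h"
      using h by (simp add: H.l_cancel_one)
    ultimately have PQ_ne: "?act P (None, \<one>\<^bsub>G\<^esub>) \<noteq> ?act Q (None, \<one>\<^bsub>G\<^esub>)" by simp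

    \<comment> \<open>In the free group \<open>R Q\<close> equals \<open>P\<close>, so evaluating
      \<open>R\<close> at the image of the base point under \<open>Q\<close> compares the two
      orders.\<close>
    let ?z = "?act Q (None, \<one>\<^bsub>G\<^esub>)"
    have z: "(None, \<one>\<^bsub>G\<^esub>) \<in> points \<times> carrier G" "?z \<in> points \<times> carrier G"
      using pt foldr_act_closed[OF PQ(2), of "(None, \<one>\<^bsub>G\<^esub>)"] by auto
    have "?act (foldr reduced_Cons R []) ?z = ?act P (None, \<one>\<^bsub>G\<^esub>)"
      using foldr_act_mult[OF R lists.Nil z(2)] foldr_act_inv_word[OF PQ(2) z(1)] by (simp add: R_def)
    moreover have "p \<notin> ball (2 * r + n + 2)" by (rule far) (simp add: c_def)
    ultimately have "foldr reduced_Cons R [] \<notin> short_relators_closure W S n"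
      using short_relators_closure_fixes[OF pG _ _ z(2)] PQ_ne by auto
    moreover have "length (foldr reduced_Cons R []) \<le> 4 * (length u + L * (c + 2)) * n"
    proof -
      \<comment> \<open>\<open>R\<close> contains \<open>u\<close> and \<open>v\<close>, up to
        inversion, four times each. Then \<open>n >= 1\<close> turns the additive constants into
        factors.\<close>
      have "length (foldr reduced_Cons R []) \<le> 4 * length u + 4 * length v"
        using length_foldr_reduced_Cons_le[of R "[]"] by (simp add: R_def P_def Q_def)
      also have "\<dots> \<le> 4 * (length u * n) + 4 * (L * ((c + 2) * n))"
      proof (intro add_mono mult_left_mono)
        show "length u \<le> length u * n" using n by simp
        have "Suc (c + n) \<le> (c + 2) * n"
          using n by (cases n) (auto simp: algebra_simps)
        then show "length v \<le> L * ((c + 2) * n)"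
          using v(2) by (meson mult_le_mono2 order_trans)
      qed auto
      also have "\<dots> = 4 * (length u + L * (c + 2)) * n"
        by (simp add: algebra_simps)
      finally show ?thesis .
    qed
    ultimately show ?thesis using rel by blast
  qed
  then show ?thesis by blast
qed

end

section \<open>Dense relatedness of the wreath product\<close>

theorem proposition4p11:
  fixes G :: "('g, 'm) monoid_scheme" and H :: "('h, 'n) monoid_scheme"
  assumes "finitely_generated_group G"
    and "finitely_generated_group H"
    and "carrier H \<noteq> {\<one>\<^bsub>H\<^esub>}"
    and "infinite (carrier G)"
  shows "densely_related (wreath_product H G)"
proof -
  interpret two_groups H G
    using assms(1,2) by (simp add: two_groups_def finitely_generated_group_def)
  obtain h where h: "h \<in> carrier H" "h \<noteq> \<one>\<^bsub>H\<^esub>"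
    using assms(3) H.one_closed by blast
  have "\<exists>c::real. c > 0 \<and> (\<forall>n::nat. n \<ge> 1 \<longrightarrow>
      (\<exists>k\<in>relation_range W S. real n \<le> real k \<and> real k \<le> c * real n))"
    if S: "finite S" "generating_set W S" for S
  proof -
    interpret generated_wreath_product H G S
      using S by unfold_locales
    obtain r where r: "\<forall>l\<in>S \<times> UNIV. \<forall>k\<in>carrier G. fst (eval_letter W l) k \<noteq> \<one>\<^bsub>H\<^esub> \<longrightarrow> k \<in> ball r"
      using support_radius by blast
    interpret bounded_wreath_product H G S r
      using r by unfold_locales blast
    obtain C where C: "\<And>n. n \<ge> 1 \<Longrightarrow>
        \<exists>w\<in>relators W S. length w \<le> C * n \<and> w \<notin> short_relators_closure W S n"
      using long_relator[OF assms(4) h] by blast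
    \<comment> \<open>Adding 1 to \<open>C\<close> makes the constant positive even for
      \<open>C = 0\<close>.\<close>
    have "\<exists>k\<in>relation_range W S. real n \<le> real k \<and> real k \<le> (real C + 1) * real n" if n: "n \<ge> 1" for n
    proof -
      obtain w where w: "w \<in> relators W S" "length w \<le> C * n" "w \<notin> short_relators_closure W S n"
        using C[OF n] by blast
      then obtain k where k: "k \<in> relation_range W S" "n < k" "k \<le> length w"
        using relation_range_between by blast
      have "k \<le> C * n" using k(3) w(2) by simp
      then have "real k \<le> real C * real n" by (metis of_nat_le_iff of_nat_mult)
      then have "real k \<le> (real C + 1) * real n" by (simp add: algebra_simps)
      then show ?thesis using k by (intro bexI[of _ k]) auto
    qed
    then show ?thesis by (intro exI[of _ "real C + 1"]) auto
  qed
  then show ?thesis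
    using finitely_generated_W[OF assms(2,1)] by (simp add: densely_related_def)
qed

end
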